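(* The completion of a universal separable metric space $\mathrm{M}$ is homogeneous.
   Context: For a metric space $\mathrm{M}=(M;d)$ let $\operatorname{dist}(\mathrm{M})=\{d(x,y)\mid x,y\in M\}$. A metric space $\mathrm{M}$ is homogeneous if for every isometry (distance preserving map) $f$ of a finite subspace of $\mathrm{M}$ to a subspace of $\mathrm{M}$ there exists an isometry of $\mathrm{M}$ onto $\mathrm{M}$ extending $f$. A metric space $\mathrm{M}$ is universal if it is homogeneous and isometrically embeds every finite metric space $\mathrm{F}$ with $\operatorname{dist}(\mathrm{F})\subseteq \operatorname{dist}(\mathrm{M})$. *)

theory Defs
  imports "HOL-Analysis.Analysis"
begin

definition dist_set :: "'a metric \<Rightarrow> real set" where
  "dist_set M = {mdist M x y |x y. x \<in> mspace M \<and> y \<in> mspace M}"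

definition isometric_embedding :: "'a metric \<Rightarrow> 'b metric \<Rightarrow> ('a \<Rightarrow> 'b) \<Rightarrow> bool" where
  "isometric_embedding M N f \<longleftrightarrow>
     f \<in> mspace M \<rightarrow> mspace N \<and>
     (\<forall>x\<in>mspace M. \<forall>y\<in>mspace M. mdist N (f x) (f y) = mdist M x y)"

definition homogeneous :: "'a metric \<Rightarrow> bool" where
  "homogeneous M \<longleftrightarrow>
     (\<forall>A f. finite A \<and> A \<subseteq> mspace M \<and> isometric_embedding (submetric M A) M f \<longrightarrow>
        (\<exists>g. isometric_embedding M M g \<and> g ` mspace M = mspace M \<and> (\<forall>x\<in>A. g x = f x)))"

text \<open>Finite metric spaces are represented with points in \<^typ>\<open>nat\<close>, since a definition
  cannot quantify over types; \<open>universal_embeds\<close> below shows that this loses no finite space.\<close>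

definition universal :: "'a metric \<Rightarrow> bool" where
  "universal M \<longleftrightarrow>
     homogeneous M \<and>
     (\<forall>F :: nat metric. finite (mspace F) \<and> dist_set F \<subseteq> dist_set M \<longrightarrow>
        (\<exists>f. isometric_embedding F M f))"

definition is_completion :: "'a metric \<Rightarrow> 'b metric \<Rightarrow> ('a \<Rightarrow> 'b) \<Rightarrow> bool" where
  "is_completion M N i \<longleftrightarrow>
     isometric_embedding M N i \<and> mcomplete_of N \<and>
     mtopology_of N closure_of (i ` mspace M) = mspace N"

lemma universal_embeds:
  fixes M :: "'a metric" and F :: "'b metric"
  assumes "universal M" and fin: "finite (mspace F)" and sub: "dist_set F \<subseteq> dist_set M"
  shows "\<exists>f. isometric_embedding F M f"
proof -
  obtain h :: "'b \<Rightarrow> nat" where h: "inj_on h (mspace F)"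
    using fin finite_imp_inj_to_nat_seg by blast
  define k where "k = inv_into (mspace F) h"
  have kh: "k (h x) = x" if "x \<in> mspace F" for x
    using h that by (simp add: k_def)
  define e where "e = (\<lambda>m n. mdist F (k m) (k n))"
  interpret G: Metric_space "h ` mspace F" e
    by unfold_locales (auto simp: e_def kh mdist_commute mdist_triangle)
  have "dist_set G.Self \<subseteq> dist_set F"
  proof
    fix r assume "r \<in> dist_set G.Self"
    then obtain x y where "x \<in> mspace F" "y \<in> mspace F" "r = e (h x) (h y)"
      by (auto simp: dist_set_def)
    then show "r \<in> dist_set F"
      by (auto simp: dist_set_def e_def kh)
  qed
  then obtain f where f: "isometric_embedding G.Self M f"
    using assms unfolding universal_def by (metis G.mspace_Self finite_imageI order_trans)
  have "e (h x) (h y) = mdist F x y" if "x \<in> mspace F" "y \<in> mspace F" for x y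
    using that by (simp add: e_def kh)
  with f have "isometric_embedding F M (f \<circ> h)"
    by (auto simp: isometric_embedding_def)
  then show ?thesis by blast
qed

lemma is_completion_exists:
  fixes M :: "'a metric"
  shows "\<exists>(N :: ('a \<Rightarrow> real) metric) i. is_completion M N i"
proof -
  obtain i :: "['a, 'a] \<Rightarrow> real" and N where "mcomplete_of N" "i \<in> mspace M \<rightarrow> mspace N"
    "mtopology_of N closure_of i ` mspace M = mspace N"
    "\<And>x y. \<lbrakk>x \<in> mspace M; y \<in> mspace M\<rbrakk> \<Longrightarrow> mdist N (i x) (i y) = mdist M x y"
    by (rule Metric_space.metric_completion[OF Metric_space_mspace_mdist[of M]]) (rule that)
  then have "is_completion M N i"
    by (simp add: is_completion_def isometric_embedding_def)
  then show ?thesis by blast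
qed

end

theory Submission
  imports Defs
begin

text \<open>Regard \<open>M\<close> as a dense subspace of its completion \<open>N\<close>, and let \<open>D\<close> be the set of distances of
  \<open>M\<close>. If the positive elements of \<open>D\<close> are bounded away from \<open>0\<close>, then \<open>M\<close> is uniformly discrete,
  hence equal to \<open>N\<close>, and there is nothing to do. Otherwise \<open>D\<close> contains arbitrarily small positive
  numbers, and these are what approximations in \<open>M\<close> are corrected with.

  Since \<open>N\<close> is complete and separable, a back-and-forth construction
  (\<open>homogeneous_if_one_point_extensions\<close>) reduces homogeneity to the extension of a finite partial
  isometry \<open>R\<close> of \<open>N\<close> to one further point \<open>x\<close>. The image of \<open>x\<close> is found as the limit of approximate
  images \<open>y\<^sub>k\<close>: the distances from \<open>y\<^sub>k\<close> to the targets of \<open>R\<close> miss their prescribed values by less than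
  \<open>r\<^sub>k\<close>, where \<open>r\<^sub>k\<close> in \<open>D\<close> tends rapidly to \<open>0\<close>. For the limit to exist, the next, more precise image
  has to be found at a distance of the order of \<open>r\<^sub>k\<close> from \<open>y\<^sub>k\<close>.

  The reason why it can be found there is \<open>universal_move_point\<close>: if the distances of two points \<open>c\<close> and
  \<open>p\<close> of \<open>M\<close> to the points of a finite set \<open>C\<close> differ by at most \<open>r\<close> in \<open>D\<close>, and \<open>r\<close> is smaller
  than the distances from \<open>c\<close> to \<open>C\<close>, then prescribing the distances of \<open>c\<close> to \<open>C\<close> and the distance \<open>r\<close> to
  \<open>p\<close> obeys the triangle inequalities, so that universality yields a point with these distances.

  This applies to points of \<open>M\<close>, whereas \<open>R\<close> relates points of \<open>N\<close>. Approximating sources and targets of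
  \<open>R\<close> by points of \<open>M\<close> gives two families that are only nearly isometric. The lemma
  \<open>nearly_isometric_families\<close> shows that an automorphism of \<open>M\<close> nevertheless moves one of them close
  to the other. It follows by induction on the number of points: each point is moved near its partner by
  \<open>universal_move_point\<close>, at a distance \<open>r\<close> that exceeds the errors made before. The errors grow
  from point to point, but as the final one can be chosen first, they all remain small.\<close>

section \<open>Metric preliminaries\<close>

lemma mdist_self [simp]: "x \<in> mspace M \<Longrightarrow> mdist M x x = 0"
  by simp

lemma mdist_quadrilateral:
  assumes "x \<in> mspace M" "y \<in> mspace M" "x' \<in> mspace M" "y' \<in> mspace M"
  shows "\<bar>mdist M x y - mdist M x' y'\<bar> \<le> mdist M x x' + mdist M y y'"
  using assms mdist_triangle[of x M x' y] mdist_triangle[of x' M y' y]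
    mdist_triangle[of x' M x y'] mdist_triangle[of x M y y']
    mdist_commute[of M x x'] mdist_commute[of M y y'] by linarith

lemma finite_positive_lower_bound:
  fixes f :: "'i \<Rightarrow> real"
  assumes "finite I" "\<And>i. i \<in> I \<Longrightarrow> 0 < f i"
  shows "\<exists>\<mu>>0. \<forall>i\<in>I. \<mu> < f i"
  using assms
proof (induction I rule: finite_induct)
  case empty
  show ?case by (auto intro: exI[of _ 1])
next
  case (insert j I)
  then obtain \<mu> where "\<mu> > 0" "\<forall>i\<in>I. \<mu> < f i" by auto
  then show ?case
    using insert.prems[of j] by (intro exI[of _ "min \<mu> (f j / 2)"]) auto
qed

definition metric_dense :: "'b metric \<Rightarrow> 'b set \<Rightarrow> bool" where
  "metric_dense N S \<longleftrightarrow> S \<subseteq> mspace N \<and> (\<forall>x\<in>mspace N. \<forall>e>0. \<exists>s\<in>S. mdist N x s < e)"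

lemma metric_dense_iff_closure_of:
  assumes "S \<subseteq> mspace N"
  shows "metric_dense N S \<longleftrightarrow> mtopology_of N closure_of S = mspace N"
proof -
  interpret N: Metric_space "mspace N" "mdist N" by simp
  show ?thesis
    using assms unfolding metric_dense_def mtopology_of_def N.metric_closure_of
    by (auto simp: N.commute subset_iff set_eq_iff)
qed

text \<open>Completeness in terms of the function \<open>mdist\<close> alone, with convergence as a limit of real numbers.\<close>

lemma mcomplete_of_limit:
  assumes "mcomplete_of N" "\<And>n::nat. \<sigma> n \<in> mspace N"
    and "\<And>e. e > 0 \<Longrightarrow> \<exists>K. \<forall>m\<ge>K. \<forall>n\<ge>K. mdist N (\<sigma> m) (\<sigma> n) < e"
  obtains l where "l \<in> mspace N" "(\<lambda>n. mdist N (\<sigma> n) l) \<longlonglongrightarrow> 0"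
proof -
  interpret N: Metric_space "mspace N" "mdist N" by simp
  have "N.MCauchy \<sigma>"
    using assms(2,3) by (auto simp: N.MCauchy_def)
  then obtain l where "limitin N.mtopology \<sigma> l sequentially"
    using assms(1) by (auto simp: mcomplete_of_def N.mcomplete_def)
  then show ?thesis
    using that by (auto simp: N.limitin_metric_dist_null)
qed

lemma mdist_tendsto:
  assumes "\<And>n::nat. \<sigma> n \<in> mspace N" "l \<in> mspace N" "v \<in> mspace N"
    and "(\<lambda>n. mdist N (\<sigma> n) l) \<longlonglongrightarrow> 0"
  shows "(\<lambda>n. mdist N (\<sigma> n) v) \<longlonglongrightarrow> mdist N l v"
proof (rule LIM_zero_cancel, rule Lim_null_comparison[OF _ assms(4)], rule always_eventually, rule allI)
  fix n
  show "norm (mdist N (\<sigma> n) v - mdist N l v) \<le> mdist N (\<sigma> n) l"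
    using mdist_quadrilateral[of "\<sigma> n" N v l v] assms(1-3) by simp
qed

section \<open>Automorphisms and one-point extensions of a universal space\<close>

definition automorphism :: "'a metric \<Rightarrow> ('a \<Rightarrow> 'a) \<Rightarrow> bool" where
  "automorphism M g \<longleftrightarrow> isometric_embedding M M g \<and> g ` mspace M = mspace M"

lemma automorphism_in: "automorphism M g \<Longrightarrow> x \<in> mspace M \<Longrightarrow> g x \<in> mspace M"
  by (auto simp: automorphism_def)

lemma automorphism_mdist:
  "automorphism M g \<Longrightarrow> x \<in> mspace M \<Longrightarrow> y \<in> mspace M \<Longrightarrow> mdist M (g x) (g y) = mdist M x y"
  by (auto simp: automorphism_def isometric_embedding_def)

lemma automorphism_comp:
  "automorphism M g \<Longrightarrow> automorphism M h \<Longrightarrow> automorphism M (h \<circ> g)"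
  by (simp add: automorphism_def isometric_embedding_def Pi_iff image_image [symmetric, of h g])

lemma automorphism_id: "automorphism M id"
  by (auto simp: automorphism_def isometric_embedding_def)

text \<open>Homogeneity for indexed families: the correspondence of the families is a well-defined map because
  points at distance \<open>0\<close> coincide.\<close>

lemma homogeneous_families:
  assumes "homogeneous M" "finite I"
    and a: "\<And>i. i \<in> I \<Longrightarrow> a i \<in> mspace M" and b: "\<And>i. i \<in> I \<Longrightarrow> b i \<in> mspace M"
    and ab: "\<And>i j. i \<in> I \<Longrightarrow> j \<in> I \<Longrightarrow> mdist M (a i) (a j) = mdist M (b i) (b j)"
  obtains g where "automorphism M g" "\<And>i. i \<in> I \<Longrightarrow> g (a i) = b i"
proof -
  define f where "f = (\<lambda>x. b (inv_into I a x))"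
  have f: "f (a i) = b i" if "i \<in> I" for i
  proof -
    have k: "inv_into I a (a i) \<in> I" "a (inv_into I a (a i)) = a i"
      using that by (auto intro: inv_into_into f_inv_into_f)
    then have "mdist M (b (inv_into I a (a i))) (b i) = 0"
      using ab[OF k(1) that] a[OF that] by (simp add: k)
    then show ?thesis using k(1) b that by (simp add: f_def)
  qed
  have "isometric_embedding (submetric M (a ` I)) M f"
    using a b ab f by (auto simp: isometric_embedding_def)
  then obtain g where "isometric_embedding M M g" "g ` mspace M = mspace M" "\<forall>x\<in>a ` I. g x = f x"
    using assms(1,2) a unfolding homogeneous_def by (metis finite_imageI image_subsetI)
  then show ?thesis
    using that f by (auto simp: automorphism_def)
qed

text \<open>The hypotheses say that \<open>A\<close> together with a new point at distance \<open>\<phi> u\<close> from each \<open>u\<close> in \<open>A\<close> is a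
  metric space with distances in those of \<open>M\<close>. The new point is modelled by \<open>None\<close>.\<close>

lemma universal_one_point_extension:
  assumes M: "universal M" and A: "finite A" "A \<subseteq> mspace M" "A \<noteq> {}"
    and D: "\<And>u. u \<in> A \<Longrightarrow> \<phi> u \<in> dist_set M" and pos: "\<And>u. u \<in> A \<Longrightarrow> 0 < \<phi> u"
    and low: "\<And>u v. u \<in> A \<Longrightarrow> v \<in> A \<Longrightarrow> \<phi> u \<le> \<phi> v + mdist M u v"
    and up: "\<And>u v. u \<in> A \<Longrightarrow> v \<in> A \<Longrightarrow> mdist M u v \<le> \<phi> u + \<phi> v"
  obtains z where "z \<in> mspace M" "\<And>u. u \<in> A \<Longrightarrow> mdist M z u = \<phi> u"
proof -
  define e where "e = (\<lambda>p q. case p of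
      None \<Rightarrow> (case q of None \<Rightarrow> 0 | Some v \<Rightarrow> \<bar>\<phi> v\<bar>)
    | Some u \<Rightarrow> (case q of None \<Rightarrow> \<bar>\<phi> u\<bar> | Some v \<Rightarrow> mdist M u v))"
  have e [simp]: "e None None = 0" "e None (Some u) = \<bar>\<phi> u\<bar>" "e (Some u) None = \<bar>\<phi> u\<bar>"
    "e (Some u) (Some v) = mdist M u v" for u v
    by (simp_all add: e_def)
  have inM: "u \<in> A \<Longrightarrow> u \<in> mspace M" for u using A by auto
  define X where "X = insert None (Some ` A)"
  interpret F: Metric_space X e
  proof
    show "0 \<le> e p q" for p q by (cases p; cases q) auto
    show "e p q = e q p" for p q by (cases p; cases q) (auto simp: mdist_commute)
    show "e p q = 0 \<longleftrightarrow> p = q" if "p \<in> X" "q \<in> X" for p q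
      using that pos inM by (fastforce simp: X_def)
    show "e p s \<le> e p q + e q s" if "p \<in> X" "q \<in> X" "s \<in> X" for p q s
    proof -
      have abs: "\<bar>\<phi> u\<bar> = \<phi> u" if "u \<in> A" for u using pos[OF that] by simp
      have low': "\<phi> u \<le> mdist M u v + \<phi> v" "\<phi> u \<le> \<phi> v + mdist M v u" if "u \<in> A" "v \<in> A" for u v
        using low[OF that] by (simp_all add: mdist_commute)
      show ?thesis
        using that low' up pos inM unfolding X_def
        by (auto simp: abs intro: less_imp_le intro!: mdist_triangle)
    qed
  qed
  have "finite (mspace F.Self)" using A(1) unfolding F.mspace_Self by (simp add: X_def)
  moreover have "dist_set F.Self \<subseteq> dist_set M"
  proof
    fix r assume "r \<in> dist_set F.Self"
    then obtain p q where pq: "p \<in> X" "q \<in> X" "r = e p q"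
      by (auto simp: dist_set_def)
    have zero: "0 \<in> dist_set M"
    proof -
      obtain u where "u \<in> A" using A by auto
      then have "u \<in> mspace M" "mdist M u u = 0" using inM by simp_all
      then show ?thesis unfolding dist_set_def by force
    qed
    have "\<bar>\<phi> u\<bar> \<in> dist_set M" if "u \<in> A" for u using D[OF that] pos[OF that] by simp
    moreover have "mdist M u v \<in> dist_set M" if "u \<in> A" "v \<in> A" for u v
      using that inM by (auto simp: dist_set_def)
    ultimately show "r \<in> dist_set M"
      using pq zero by (auto simp: X_def)
  qed
  ultimately obtain k where k: "isometric_embedding F.Self M k"
    using universal_embeds[OF M, of F.Self] by auto
  then have kin: "\<And>p. p \<in> X \<Longrightarrow> k p \<in> mspace M"
    and kd: "\<And>p q. p \<in> X \<Longrightarrow> q \<in> X \<Longrightarrow> mdist M (k p) (k q) = e p q"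
    by (auto simp: isometric_embedding_def)
  have SX: "Some u \<in> X" if "u \<in> A" for u using that by (simp add: X_def)
  have NX: "None \<in> X" by (simp add: X_def)
  \<comment> \<open>The copy of \<open>A\<close> inside the embedded space need not be \<open>A\<close> itself; homogeneity moves it there.\<close>
  obtain g where g: "automorphism M g" "\<And>u. u \<in> A \<Longrightarrow> g (k (Some u)) = u"
  proof (rule homogeneous_families[of M A "\<lambda>u. k (Some u)" "\<lambda>u. u"])
    show "homogeneous M" using M by (simp add: universal_def)
  qed (use A kin kd SX inM in auto)
  show ?thesis
  proof (rule that[of "g (k None)"])
    show "g (k None) \<in> mspace M" using g kin NX by (simp add: automorphism_in)
    fix u assume u: "u \<in> A"
    have "mdist M (g (k None)) (g (k (Some u))) = e None (Some u)"
      using g(1) kin kd NX SX[OF u] by (simp add: automorphism_mdist)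
    then show "mdist M (g (k None)) u = \<phi> u" using g(2)[OF u] pos[OF u] by simp
  qed
qed

text \<open>The new position of \<open>c\<close> is a point whose distances to \<open>C\<close> are those of \<open>c\<close>, and whose distance to \<open>p\<close>
  is \<open>r\<close>. The bounds \<open>close\<close> and \<open>far\<close> take care of the triangles formed by \<open>p\<close>, the new point
  and a point of \<open>C\<close>: the side \<open>r\<close> has to be at least the difference of the two other sides, and at most
  their sum.\<close>

lemma universal_move_point:
  assumes M: "universal M" and C: "finite C" "C \<subseteq> mspace M"
    and c: "c \<in> mspace M" and p: "p \<in> mspace M"
    and r: "r \<in> dist_set M" "0 < r"
    and close: "\<And>u. u \<in> C \<Longrightarrow> \<bar>mdist M c u - mdist M p u\<bar> \<le> r"
    and far: "\<And>u. u \<in> C \<Longrightarrow> r < mdist M c u"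
  obtains h where "automorphism M h" "\<And>u. u \<in> C \<Longrightarrow> h u = u" "mdist M p (h c) = r"
proof -
  have inM: "u \<in> C \<Longrightarrow> u \<in> mspace M" for u using C by auto
  have pC: "u \<noteq> p" if "u \<in> C" for u
    using close[OF that] far[OF that] p r(2) by auto
  have cC: "u \<noteq> c" if "u \<in> C" for u
    using far[OF that] c r(2) by auto
  define \<phi> where "\<phi> = (\<lambda>u. if u = p then r else mdist M c u)"
  obtain z where z: "z \<in> mspace M" "\<And>u. u \<in> insert p C \<Longrightarrow> mdist M z u = \<phi> u"
  proof (rule universal_one_point_extension[of M "insert p C" \<phi>])
    show "universal M" "finite (insert p C)" "insert p C \<subseteq> mspace M" "insert p C \<noteq> {}"
      using M C p by auto
    show "\<phi> u \<in> dist_set M" if "u \<in> insert p C" for u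
      using that r c inM by (auto simp: \<phi>_def dist_set_def)
    show "0 < \<phi> u" if "u \<in> insert p C" for u
      using that r far[of u] by (auto simp: \<phi>_def)
    fix u v assume u: "u \<in> insert p C" and v: "v \<in> insert p C"
    have uM: "u \<in> mspace M" "v \<in> mspace M" using u v p inM by auto
    show "\<phi> u \<le> \<phi> v + mdist M u v"
      using u v close[of u] close[of v] far[of u] far[of v] p
        mdist_triangle[OF c uM(2) uM(1)] mdist_commute[of M u v] by (auto simp: \<phi>_def)
    show "mdist M u v \<le> \<phi> u + \<phi> v"
      using u v close[of u] close[of v] far[of u] far[of v] r p
        mdist_triangle[OF uM(1) c uM(2)] mdist_commute[of M u c] mdist_commute[of M u v]
      by (auto simp: \<phi>_def)
  qed blast
  have zp: "mdist M z p = r" using z(2)[of p] by (simp add: \<phi>_def)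
  have zC: "mdist M z u = mdist M c u" if "u \<in> C" for u
    using z(2)[of u] pC[OF that] that by (simp add: \<phi>_def)
  obtain h where h: "automorphism M h"
    "\<And>u. u \<in> insert c C \<Longrightarrow> h u = (if u = c then z else u)"
  proof (rule homogeneous_families[of M "insert c C" "\<lambda>u. u" "\<lambda>u. if u = c then z else u"])
    show "homogeneous M" using M by (simp add: universal_def)
    show "mdist M u v = mdist M (if u = c then z else u) (if v = c then z else v)"
      if "u \<in> insert c C" "v \<in> insert c C" for u v
      using that c z(1) zC[of u] zC[of v] mdist_commute[of M u c] mdist_commute[of M u z] by auto
  qed (use C c z inM in auto)
  show ?thesis
  proof (rule that[OF h(1)])
    show "h u = u" if "u \<in> C" for u using h(2)[of u] cC[OF that] that by simp
    show "mdist M p (h c) = r" using h(2)[of c] zp by (simp add: mdist_commute)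
  qed
qed

section \<open>Nearly isometric families\<close>

definition small_distances :: "'a metric \<Rightarrow> bool" where
  "small_distances M \<longleftrightarrow> (\<forall>e>0. \<exists>r\<in>dist_set M. 0 < r \<and> r < e)"

text \<open>The tolerance \<open>s\<close> depends on the index set, on the separation \<open>\<mu>\<close> and on \<open>\<epsilon>\<close>, but not on the
  families: it is needed before approximations of given families in the completion can be chosen.\<close>

lemma nearly_isometric_families:
  fixes M :: "'a metric" and I :: "'i set"
  assumes M: "universal M" and D: "small_distances M"
    and "finite I" and "0 < \<mu>" and "0 < \<epsilon>"
  shows "\<exists>s>0. \<forall>a\<in>I \<rightarrow> mspace M. \<forall>b\<in>I \<rightarrow> mspace M.
      (\<forall>i\<in>I. \<forall>j\<in>I. \<bar>mdist M (a i) (a j) - mdist M (b i) (b j)\<bar> \<le> s) \<longrightarrow>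
      (\<forall>i\<in>I. \<forall>j\<in>I. i \<noteq> j \<longrightarrow> \<mu> \<le> mdist M (b i) (b j)) \<longrightarrow>
      (\<exists>g. automorphism M g \<and> (\<forall>i\<in>I. mdist M (a i) (g (b i)) \<le> \<epsilon>))"
  using assms(3,5)
proof (induction I arbitrary: \<epsilon> rule: finite_induct)
  case empty
  show ?case
  proof (intro exI[of _ "1 :: real"] conjI ballI impI)
    show "\<exists>g. automorphism M g \<and> (\<forall>i\<in>{}. mdist M (a i) (g (b i)) \<le> \<epsilon>)" for a b :: "'i \<Rightarrow> 'a"
      using automorphism_id by (intro exI[of _ id]) simp
  qed simp
next
  case (insert n I)
  obtain r where r: "r \<in> dist_set M" "0 < r" "r < min \<epsilon> \<mu>"
  proof -
    have "0 < min \<epsilon> \<mu>" using insert.prems \<open>0 < \<mu>\<close> by simp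
    then show ?thesis using D that unfolding small_distances_def by blast
  qed
  \<comment> \<open>Half of \<open>r\<close> is spent on the points already placed, half on the mismatch of the data;
    the distance \<open>r\<close> then remains available for the new point.\<close>
  obtain s' where s': "s' > 0" and IH: "\<forall>a\<in>I \<rightarrow> mspace M. \<forall>b\<in>I \<rightarrow> mspace M.
      (\<forall>i\<in>I. \<forall>j\<in>I. \<bar>mdist M (a i) (a j) - mdist M (b i) (b j)\<bar> \<le> s') \<longrightarrow>
      (\<forall>i\<in>I. \<forall>j\<in>I. i \<noteq> j \<longrightarrow> \<mu> \<le> mdist M (b i) (b j)) \<longrightarrow>
      (\<exists>g. automorphism M g \<and> (\<forall>i\<in>I. mdist M (a i) (g (b i)) \<le> r / 2))"
    using insert.IH[OF half_gt_zero[OF r(2)]] by (elim exE conjE) (rule that)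
  show ?case
  proof (intro exI[of _ "min s' (r/2)"] conjI ballI impI)
    show "0 < min s' (r/2)" using s' r by simp
    fix a b
    assume "a \<in> insert n I \<rightarrow> mspace M" and "b \<in> insert n I \<rightarrow> mspace M"
      and ab: "\<forall>i\<in>insert n I. \<forall>j\<in>insert n I.
          \<bar>mdist M (a i) (a j) - mdist M (b i) (b j)\<bar> \<le> min s' (r / 2)"
      and sep: "\<forall>i\<in>insert n I. \<forall>j\<in>insert n I. i \<noteq> j \<longrightarrow> \<mu> \<le> mdist M (b i) (b j)"
    then have a: "\<And>i. i \<in> insert n I \<Longrightarrow> a i \<in> mspace M"
      and b: "\<And>i. i \<in> insert n I \<Longrightarrow> b i \<in> mspace M" by blast+
    obtain g where g: "automorphism M g" "\<forall>i\<in>I. mdist M (a i) (g (b i)) \<le> r / 2"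
    proof -
      have "a \<in> I \<rightarrow> mspace M" "b \<in> I \<rightarrow> mspace M" using a b by auto
      moreover have "\<forall>i\<in>I. \<forall>j\<in>I. \<bar>mdist M (a i) (a j) - mdist M (b i) (b j)\<bar> \<le> s'"
        using ab by auto
      moreover have "\<forall>i\<in>I. \<forall>j\<in>I. i \<noteq> j \<longrightarrow> \<mu> \<le> mdist M (b i) (b j)" using sep by blast
      ultimately have "\<exists>g. automorphism M g \<and> (\<forall>i\<in>I. mdist M (a i) (g (b i)) \<le> r / 2)"
        by (rule IH[THEN bspec, THEN bspec, THEN mp, THEN mp])
      then show ?thesis using that by blast
    qed
    have gb: "g (b i) \<in> mspace M" if "i \<in> insert n I" for i
      by (rule automorphism_in[OF g(1) b[OF that]])
    have gd: "mdist M (g (b n)) (g (b i)) = mdist M (b n) (b i)" if "i \<in> I" for i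
      using automorphism_mdist[OF g(1) b b] that by simp
    obtain h where h: "automorphism M h" "\<And>u. u \<in> (\<lambda>i. g (b i)) ` I \<Longrightarrow> h u = u"
      "mdist M (a n) (h (g (b n))) = r"
    proof (rule universal_move_point[of M "(\<lambda>i. g (b i)) ` I" "g (b n)" "a n" r])
      fix u assume "u \<in> (\<lambda>i. g (b i)) ` I"
      then obtain i where i: "i \<in> I" "u = g (b i)" by auto
      have "\<bar>mdist M (a n) (a i) - mdist M (b n) (b i)\<bar> \<le> r / 2"
        using bspec[OF bspec[OF ab, of n], of i] i(1) by simp
      moreover have "\<bar>mdist M (a n) (a i) - mdist M (a n) u\<bar> \<le> r / 2"
        using mdist_quadrilateral[of "a n" M "a i" "a n" u] a[of n] a[of i] i bspec[OF g(2) i(1)] gb[of i]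
        by simp
      ultimately show "\<bar>mdist M (g (b n)) u - mdist M (a n) u\<bar> \<le> r"
        using gd[OF i(1), folded i(2)] by linarith
      have "i \<noteq> n" using i(1) insert.hyps by auto
      then have "\<mu> \<le> mdist M (b n) (b i)" using bspec[OF bspec[OF sep, of n], of i] i(1) by simp
      then show "r < mdist M (g (b n)) u" using r(3) gd[OF i(1)] i(2) by simp
    next
      show "(\<lambda>i. g (b i)) ` I \<subseteq> mspace M" "g (b n) \<in> mspace M" "a n \<in> mspace M"
        using gb a by blast+
      show "universal M" "finite ((\<lambda>i. g (b i)) ` I)" "r \<in> dist_set M" "0 < r"
        using M insert.hyps(1) r by simp_all
    qed blast
    have "mdist M (a i) ((h \<circ> g) (b i)) \<le> \<epsilon>" if "i \<in> insert n I" for i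
    proof (cases "i = n")
      case True then show ?thesis using h(3) r by simp
    next
      case False
      then have "i \<in> I" using that by simp
      then have "h (g (b i)) = g (b i)" "mdist M (a i) (g (b i)) \<le> r / 2"
        using h(2)[of "g (b i)"] bspec[OF g(2), of i] by simp_all
      then show ?thesis using r by simp
    qed
    then show "\<exists>g. automorphism M g \<and> (\<forall>i\<in>insert n I. mdist M (a i) (g (b i)) \<le> \<epsilon>)"
      by (intro exI[of _ "h \<circ> g"] conjI ballI automorphism_comp[OF g(1) h(1)])
  qed
qed

section \<open>Refining an approximate image in the completion\<close>

text \<open>A relation instead of a map, so that passing to the inverse exchanges the two halves of the
  back-and-forth construction.\<close>

definition partial_isometry :: "'b metric \<Rightarrow> ('b \<times> 'b) set \<Rightarrow> bool" where
  "partial_isometry N R \<longleftrightarrow> R \<subseteq> mspace N \<times> mspace N \<and>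
     (\<forall>p\<in>R. \<forall>q\<in>R. mdist N (fst p) (fst q) = mdist N (snd p) (snd q))"

lemma partial_isometryD:
  assumes "partial_isometry N R" "p \<in> R"
  shows "fst p \<in> mspace N" "snd p \<in> mspace N"
    and "q \<in> R \<Longrightarrow> mdist N (fst p) (fst q) = mdist N (snd p) (snd q)"
  using assms by (auto simp: partial_isometry_def)

lemma partial_isometry_converse:
  assumes R: "partial_isometry N R"
  shows "partial_isometry N (R\<inverse>)"
  unfolding partial_isometry_def
proof (intro conjI ballI)
  show "R\<inverse> \<subseteq> mspace N \<times> mspace N" using R by (auto simp: partial_isometry_def)
  have swap: "(snd p, fst p) \<in> R" if "p \<in> R\<inverse>" for p using that by auto
  fix p q assume "p \<in> R\<inverse>" "q \<in> R\<inverse>"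
  then show "mdist N (fst p) (fst q) = mdist N (snd p) (snd q)"
    using partial_isometryD(3)[OF R swap swap] by simp
qed

lemma partial_isometry_insert:
  assumes R: "partial_isometry N R" and x: "x \<in> mspace N" and y: "y \<in> mspace N"
    and d: "\<And>p. p \<in> R \<Longrightarrow> mdist N y (snd p) = mdist N x (fst p)"
  shows "partial_isometry N (insert (x, y) R)"
  unfolding partial_isometry_def
proof (intro conjI ballI)
  show "insert (x, y) R \<subseteq> mspace N \<times> mspace N" using R x y by (auto simp: partial_isometry_def)
  fix p q assume p: "p \<in> insert (x, y) R" and q: "q \<in> insert (x, y) R"
  show "mdist N (fst p) (fst q) = mdist N (snd p) (snd q)"
  proof (cases "p \<in> R")
    case pR: True
    show ?thesis
    proof (cases "q \<in> R")
      case True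
      then show ?thesis by (rule partial_isometryD(3)[OF R pR])
    next
      case False
      then have "q = (x, y)" using q by simp
      then show ?thesis using d[OF pR] by (simp add: mdist_commute)
    qed
  next
    case False
    then have pxy: "p = (x, y)" using p by simp
    show ?thesis
    proof (cases "q \<in> R")
      case True
      then show ?thesis using d[OF True] pxy by simp
    next
      case False
      then show ?thesis using pxy q x y by simp
    qed
  qed
qed

text \<open>The case in which the distance set accumulates at \<open>0\<close>.\<close>

locale universal_completion =
  fixes M :: "'a metric" and N :: "'b metric" and i :: "'a \<Rightarrow> 'b"
  assumes universal: "universal M" and small: "small_distances M"
    and completion: "is_completion M N i"
begin

lemma i_in [simp]: "x \<in> mspace M \<Longrightarrow> i x \<in> mspace N"
  using completion by (auto simp: is_completion_def isometric_embedding_def)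

lemma i_mdist [simp]: "x \<in> mspace M \<Longrightarrow> y \<in> mspace M \<Longrightarrow> mdist N (i x) (i y) = mdist M x y"
  using completion by (auto simp: is_completion_def isometric_embedding_def)

lemma approximant:
  assumes "x \<in> mspace N" "0 < e"
  shows "\<exists>m. m \<in> mspace M \<and> mdist N (i m) x < e"
proof -
  have "i ` mspace M \<subseteq> mspace N" by auto
  moreover have "mtopology_of N closure_of (i ` mspace M) = mspace N"
    using completion by (simp add: is_completion_def)
  ultimately have "metric_dense N (i ` mspace M)" by (simp only: metric_dense_iff_closure_of)
  then obtain m where "m \<in> mspace M" "mdist N x (i m) < e"
    using assms unfolding metric_dense_def by blast
  then show ?thesis unfolding mdist_commute[of N x] by blast
qed

text \<open>A partial isometry of the completion is approximated by an automorphism of the dense subspace.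
  Sources and targets of \<open>R\<close> are replaced by nearby points of \<open>M\<close>; these form nearly isometric families,
  to which \<open>nearly_isometric_families\<close> applies with \<open>R\<close> itself as index set.\<close>

lemma approximating_automorphism:
  assumes fin: "finite R" and R: "partial_isometry N R" and \<epsilon>: "0 < \<epsilon>"
  obtains g a where "automorphism M g" "\<And>p. p \<in> R \<Longrightarrow> a p \<in> mspace M"
    "\<And>p. p \<in> R \<Longrightarrow> mdist N (i (a p)) (fst p) < \<epsilon>"
    "\<And>p. p \<in> R \<Longrightarrow> mdist N (i (g (a p))) (snd p) < \<epsilon>"
proof -
  have RN: "fst p \<in> mspace N" "snd p \<in> mspace N" if "p \<in> R" for p
    using partial_isometryD[OF R that] by simp_all
  have Rd: "mdist N (fst p) (fst q) = mdist N (snd p) (snd q)" if "p \<in> R" "q \<in> R" for p q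
    using that by (rule partial_isometryD(3)[OF R])
  have "0 < mdist N (fst p) (fst q)" if "p \<in> R" "q \<in> R" "p \<noteq> q" for p q
    using that RN Rd[OF that(1,2)] by (metis less_eq_real_def mdist_nonneg mdist_zero prod_eqI)
  then have "\<exists>\<mu>>0. \<forall>w\<in>{w \<in> R \<times> R. fst w \<noteq> snd w}. \<mu> < mdist N (fst (fst w)) (fst (snd w))"
    using fin by (intro finite_positive_lower_bound) auto
  then obtain \<mu> where \<mu>: "\<mu> > 0"
    "\<And>p q. p \<in> R \<Longrightarrow> q \<in> R \<Longrightarrow> p \<noteq> q \<Longrightarrow> \<mu> < mdist N (fst p) (fst q)"
    by fastforce
  obtain s where s: "s > 0" and near: "\<forall>b\<in>R \<rightarrow> mspace M. \<forall>a\<in>R \<rightarrow> mspace M.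
      (\<forall>p\<in>R. \<forall>q\<in>R. \<bar>mdist M (b p) (b q) - mdist M (a p) (a q)\<bar> \<le> s) \<longrightarrow>
      (\<forall>p\<in>R. \<forall>q\<in>R. p \<noteq> q \<longrightarrow> \<mu> / 2 \<le> mdist M (a p) (a q)) \<longrightarrow>
      (\<exists>g. automorphism M g \<and> (\<forall>p\<in>R. mdist M (b p) (g (a p)) \<le> \<epsilon> / 2))"
    using nearly_isometric_families[OF universal small fin half_gt_zero[OF \<mu>(1)] half_gt_zero[OF \<epsilon>]]
    by (elim exE conjE) (rule that)
  \<comment> \<open>Replacing both end points changes a distance by at most \<open>2 * \<delta>\<close>: twice this is at most \<open>s\<close>, as the
    distances of two families are compared, and once is at most \<open>\<mu> / 2\<close>, so that separation by \<open>\<mu> / 2\<close> remains.\<close>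
  define \<delta> where "\<delta> = min (\<epsilon> / 2) (min (\<mu> / 4) (s / 4))"
  have \<delta>: "0 < \<delta>" "\<delta> \<le> \<epsilon> / 2" "\<delta> \<le> \<mu> / 4" "\<delta> \<le> s / 4"
    using s \<mu>(1) \<epsilon> by (auto simp: \<delta>_def)
  have "\<forall>p\<in>R. \<exists>m. m \<in> mspace M \<and> mdist N (i m) (fst p) < \<delta>"
    using approximant RN \<delta>(1) by blast
  then obtain a where a: "\<And>p. p \<in> R \<Longrightarrow> a p \<in> mspace M"
      "\<And>p. p \<in> R \<Longrightarrow> mdist N (i (a p)) (fst p) < \<delta>"
    by metis
  have "\<forall>p\<in>R. \<exists>m. m \<in> mspace M \<and> mdist N (i m) (snd p) < \<delta>"
    using approximant RN \<delta>(1) by blast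
  then obtain b where b: "\<And>p. p \<in> R \<Longrightarrow> b p \<in> mspace M"
      "\<And>p. p \<in> R \<Longrightarrow> mdist N (i (b p)) (snd p) < \<delta>"
    by metis
  have ad: "\<bar>mdist M (a p) (a q) - mdist N (fst p) (fst q)\<bar> \<le> 2 * \<delta>" if "p \<in> R" "q \<in> R" for p q
    using mdist_quadrilateral[of "i (a p)" N "i (a q)" "fst p" "fst q"] a[OF that(1)] a[OF that(2)]
      RN that by simp
  have bd: "\<bar>mdist M (b p) (b q) - mdist N (snd p) (snd q)\<bar> \<le> 2 * \<delta>" if "p \<in> R" "q \<in> R" for p q
    using mdist_quadrilateral[of "i (b p)" N "i (b q)" "snd p" "snd q"] b[OF that(1)] b[OF that(2)]
      RN that by simp
  have bs: "\<bar>mdist M (b p) (b q) - mdist M (a p) (a q)\<bar> \<le> s" if "p \<in> R" "q \<in> R" for p q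
    using ad[OF that] bd[OF that] Rd[OF that] \<delta>(4) by linarith
  have as: "\<mu> / 2 \<le> mdist M (a p) (a q)" if "p \<in> R" "q \<in> R" "p \<noteq> q" for p q
    using ad[OF that(1,2)] \<mu>(2)[OF that] \<delta>(3) by linarith
  obtain g where g: "automorphism M g" "\<And>p. p \<in> R \<Longrightarrow> mdist M (b p) (g (a p)) \<le> \<epsilon> / 2"
  proof -
    have "b \<in> R \<rightarrow> mspace M" "a \<in> R \<rightarrow> mspace M" using a(1) b(1) by auto
    moreover have "\<forall>p\<in>R. \<forall>q\<in>R. \<bar>mdist M (b p) (b q) - mdist M (a p) (a q)\<bar> \<le> s"
      using bs by blast
    moreover have "\<forall>p\<in>R. \<forall>q\<in>R. p \<noteq> q \<longrightarrow> \<mu> / 2 \<le> mdist M (a p) (a q)"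
      using as by blast
    ultimately have "\<exists>g. automorphism M g \<and> (\<forall>p\<in>R. mdist M (b p) (g (a p)) \<le> \<epsilon> / 2)"
      by (rule near[THEN bspec, THEN bspec, THEN mp, THEN mp])
    then show ?thesis using that by metis
  qed
  have "mdist N (i (g (a p))) (snd p) < \<epsilon>" if "p \<in> R" for p
  proof -
    have gM: "g (a p) \<in> mspace M" using g(1) a(1)[OF that] by (rule automorphism_in)
    then show ?thesis
      using mdist_triangle[of "i (g (a p))" N "i (b p)" "snd p"] b[OF that] g(2)[OF that] RN[OF that]
        \<delta>(2) by (simp add: mdist_commute)
  qed
  moreover have "mdist N (i (a p)) (fst p) < \<epsilon>" if "p \<in> R" for p
    using a(2)[OF that] \<delta>(2) \<epsilon> by linarith
  ultimately show ?thesis using that g(1) a(1) by blast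
qed

text \<open>The point \<open>y\<close> is an image of \<open>x\<close> with errors below \<open>r\<close>, and \<open>y'\<close> is one with errors below \<open>\<epsilon>\<close> that is
  nevertheless only about \<open>r\<close> away from \<open>y\<close>. An automorphism that approximates \<open>R\<close> carries an approximation
  of \<open>x\<close> to a point \<open>c\<close> with almost the right distances to the targets, but possibly far from \<open>y\<close>;
  \<open>universal_move_point\<close> then brings \<open>c\<close> close to \<open>y\<close> without altering these distances.\<close>

lemma refine_approximate_image:
  assumes fin: "finite R" and R: "partial_isometry N R"
    and x: "x \<in> mspace N" and y: "y \<in> mspace N"
    and r: "r \<in> dist_set M" "0 < r" and \<epsilon>: "0 < \<epsilon>"
    and close: "\<And>p. p \<in> R \<Longrightarrow> \<bar>mdist N y (snd p) - mdist N x (fst p)\<bar> < r"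
    and far: "\<And>p. p \<in> R \<Longrightarrow> r < mdist N x (fst p)"
  obtains y' where "y' \<in> mspace N" "mdist N y y' < r + \<epsilon>"
    "\<And>p. p \<in> R \<Longrightarrow> \<bar>mdist N y' (snd p) - mdist N x (fst p)\<bar> < \<epsilon>"
proof -
  have RN: "fst p \<in> mspace N" "snd p \<in> mspace N" if "p \<in> R" for p
    using partial_isometryD[OF R that] by simp_all
  define slack where "slack = (\<lambda>p. min (r - \<bar>mdist N y (snd p) - mdist N x (fst p)\<bar>)
      (mdist N x (fst p) - r))"
  have "0 < slack p" if "p \<in> R" for p
    using close[OF that] far[OF that] by (simp add: slack_def)
  then obtain \<tau> where \<tau>: "\<tau> > 0" "\<forall>p\<in>R. \<tau> < slack p"
    using finite_positive_lower_bound[OF fin, of slack] by blast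
  have slack: "\<tau> < r - \<bar>mdist N y (snd p) - mdist N x (fst p)\<bar>"
    "\<tau> < mdist N x (fst p) - r" if "p \<in> R" for p
    using bspec[OF \<tau>(2) that] by (simp_all add: slack_def)
  \<comment> \<open>The slack in \<open>close\<close> and \<open>far\<close> absorbs the replacement of \<open>x\<close>, \<open>y\<close> and the points of \<open>R\<close> by
    points of \<open>M\<close>, which shifts each of the two compared distances by at most \<open>2 * \<eta>\<close>.\<close>
  define \<eta> where "\<eta> = min (\<tau> / 4) (\<epsilon> / 4)"
  have \<eta>: "0 < \<eta>" "4 * \<eta> \<le> \<tau>" "4 * \<eta> \<le> \<epsilon>" using \<tau>(1) \<epsilon> by (auto simp: \<eta>_def)
  obtain g a where g: "automorphism M g" and a: "\<And>p. p \<in> R \<Longrightarrow> a p \<in> mspace M"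
    "\<And>p. p \<in> R \<Longrightarrow> mdist N (i (a p)) (fst p) < \<eta>"
    and ga: "\<And>p. p \<in> R \<Longrightarrow> mdist N (i (g (a p))) (snd p) < \<eta>"
    using approximating_automorphism[OF fin R \<eta>(1)] by metis
  obtain x0 where x0: "x0 \<in> mspace M" "mdist N (i x0) x < \<eta>" using approximant[OF x \<eta>(1)] by auto
  obtain y0 where y0: "y0 \<in> mspace M" "mdist N (i y0) y < \<eta>" using approximant[OF y \<eta>(1)] by auto
  have gM: "g (a p) \<in> mspace M" if "p \<in> R" for p using g a(1)[OF that] by (rule automorphism_in)
  have gx0: "g x0 \<in> mspace M" using g x0(1) by (rule automorphism_in)
  have c: "\<bar>mdist M (g x0) (g (a p)) - mdist N x (fst p)\<bar> \<le> 2 * \<eta>" if "p \<in> R" for p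
    using mdist_quadrilateral[of "i x0" N "i (a p)" x "fst p"] x0 a[OF that] x RN[OF that]
    by (simp add: automorphism_mdist[OF g])
  have y0d: "\<bar>mdist M y0 (g (a p)) - mdist N y (snd p)\<bar> \<le> 2 * \<eta>" if "p \<in> R" for p
    using mdist_quadrilateral[of "i y0" N "i (g (a p))" y "snd p"] y0 gM[OF that] ga[OF that] y RN[OF that]
    by simp
  obtain h where h: "automorphism M h" "\<And>u. u \<in> (\<lambda>p. g (a p)) ` R \<Longrightarrow> h u = u"
    "mdist M y0 (h (g x0)) = r"
  proof (rule universal_move_point[of M "(\<lambda>p. g (a p)) ` R" "g x0" y0 r])
    fix u assume "u \<in> (\<lambda>p. g (a p)) ` R"
    then obtain p where p: "p \<in> R" "u = g (a p)" by auto
    show "\<bar>mdist M (g x0) u - mdist M y0 u\<bar> \<le> r"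
      using c[OF p(1)] y0d[OF p(1)] slack[OF p(1)] \<eta>(2) unfolding p(2) by linarith
    show "r < mdist M (g x0) u"
      using c[OF p(1)] slack[OF p(1)] \<eta>(1,2) unfolding p(2) by linarith
  next
    show "(\<lambda>p. g (a p)) ` R \<subseteq> mspace M" using gM by blast
    show "universal M" "finite ((\<lambda>p. g (a p)) ` R)" "g x0 \<in> mspace M" "y0 \<in> mspace M"
      "r \<in> dist_set M" "0 < r"
      using universal fin r y0(1) gx0 by simp_all
  qed blast
  define z where "z = h (g x0)"
  have z: "z \<in> mspace M" unfolding z_def using h(1) gx0 by (rule automorphism_in)
  show ?thesis
  proof (rule that[of "i z"])
    show "i z \<in> mspace N" using z by simp
    show "mdist N y (i z) < r + \<epsilon>"
      using mdist_triangle[of y N "i y0" "i z"] y y0 z h(3) \<eta>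
      by (simp add: mdist_commute z_def)
    fix p assume p: "p \<in> R"
    have "mdist M z (g (a p)) = mdist M (h (g x0)) (h (g (a p)))"
      using h(2)[of "g (a p)"] p by (simp add: z_def)
    then have zd: "mdist M z (g (a p)) = mdist M (g x0) (g (a p))"
      using automorphism_mdist[OF h(1) gx0 gM[OF p]] by simp
    have "\<bar>mdist M z (g (a p)) - mdist N (i z) (snd p)\<bar> \<le> \<eta>"
      using mdist_quadrilateral[of "i z" N "i (g (a p))" "i z" "snd p"] z gM[OF p] ga[OF p] RN[OF p]
      by simp
    then show "\<bar>mdist N (i z) (snd p) - mdist N x (fst p)\<bar> < \<epsilon>"
      using c[OF p] zd \<eta> by linarith
  qed
qed

lemma approximate_image:
  assumes fin: "finite R" and R: "partial_isometry N R" and x: "x \<in> mspace N" and \<epsilon>: "0 < \<epsilon>"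
  obtains y where "y \<in> mspace N" "\<And>p. p \<in> R \<Longrightarrow> \<bar>mdist N y (snd p) - mdist N x (fst p)\<bar> < \<epsilon>"
proof -
  have RN: "fst p \<in> mspace N" "snd p \<in> mspace N" if "p \<in> R" for p
    using partial_isometryD[OF R that] by simp_all
  have \<eta>: "0 < \<epsilon> / 4" using \<epsilon> by simp
  obtain g a where g: "automorphism M g" and a: "\<And>p. p \<in> R \<Longrightarrow> a p \<in> mspace M"
    "\<And>p. p \<in> R \<Longrightarrow> mdist N (i (a p)) (fst p) < \<epsilon> / 4"
    and ga: "\<And>p. p \<in> R \<Longrightarrow> mdist N (i (g (a p))) (snd p) < \<epsilon> / 4"
    using approximating_automorphism[OF fin R \<eta>] by metis
  obtain x0 where x0: "x0 \<in> mspace M" "mdist N (i x0) x < \<epsilon> / 4" using approximant[OF x \<eta>] by auto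
  have gx0: "g x0 \<in> mspace M" using g x0(1) by (rule automorphism_in)
  show ?thesis
  proof (rule that[of "i (g x0)"])
    show "i (g x0) \<in> mspace N" using gx0 by simp
    fix p assume p: "p \<in> R"
    have gM: "g (a p) \<in> mspace M" using g a(1)[OF p] by (rule automorphism_in)
    have "\<bar>mdist M (g x0) (g (a p)) - mdist N x (fst p)\<bar> \<le> mdist N (i x0) x + mdist N (i (a p)) (fst p)"
      using mdist_quadrilateral[of "i x0" N "i (a p)" x "fst p"] x0 a[OF p] x RN[OF p]
      by (simp add: automorphism_mdist[OF g])
    moreover have "\<bar>mdist M (g x0) (g (a p)) - mdist N (i (g x0)) (snd p)\<bar>
        \<le> mdist N (i (g (a p))) (snd p)"
      using mdist_quadrilateral[of "i (g x0)" N "i (g (a p))" "i (g x0)" "snd p"] gx0 gM RN[OF p]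
      by simp
    ultimately show "\<bar>mdist N (i (g x0)) (snd p) - mdist N x (fst p)\<bar> < \<epsilon>"
      using x0(2) a(2)[OF p] ga[OF p] \<eta> by linarith
  qed
qed

text \<open>Successive refinements of an approximate image, with summable steps, converge to an exact image.\<close>

lemma completion_one_point_extension:
  assumes fin: "finite R" and R: "partial_isometry N R" and x: "x \<in> mspace N"
  shows "\<exists>y. partial_isometry N (insert (x, y) R)"
proof (cases "x \<in> Domain R")
  case True
  then obtain y where "(x, y) \<in> R" by auto
  then show ?thesis using R by (metis insert_absorb)
next
  case False
  have RN: "fst p \<in> mspace N" "snd p \<in> mspace N" if "p \<in> R" for p
    using partial_isometryD[OF R that] by simp_all
  have "0 < mdist N x (fst p)" if "p \<in> R" for p
  proof -
    have "x \<noteq> fst p" using False that by (metis DomainI prod.collapse)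
    then show ?thesis using x RN[OF that] by (metis less_eq_real_def mdist_nonneg mdist_zero)
  qed
  then obtain \<mu> where \<mu>: "\<mu> > 0" "\<And>p. p \<in> R \<Longrightarrow> \<mu> < mdist N x (fst p)"
    using finite_positive_lower_bound[OF fin, of "\<lambda>p. mdist N x (fst p)"] by blast
  have "\<exists>r. r \<in> dist_set M \<and> 0 < r \<and> r < min \<mu> ((1/2) ^ k)" for k :: nat
  proof -
    have "0 < min \<mu> ((1/2) ^ k)" using \<mu>(1) by simp
    then show ?thesis using small unfolding small_distances_def by blast
  qed
  then obtain r :: "nat \<Rightarrow> real" where r: "\<And>k. r k \<in> dist_set M" "\<And>k. 0 < r k" "\<And>k. r k < \<mu>"
    "\<And>k. r k < (1/2) ^ k"
    by (metis min_less_iff_conj)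
  define P where "P = (\<lambda>k y. y \<in> mspace N \<and>
    (\<forall>p\<in>R. \<bar>mdist N y (snd p) - mdist N x (fst p)\<bar> < r k))"
  have "\<exists>\<sigma>. \<forall>k. P k (\<sigma> k) \<and> mdist N (\<sigma> k) (\<sigma> (Suc k)) < 2 * (1/2) ^ k"
  proof (rule dependent_nat_choice)
    show "\<exists>y. P 0 y"
      using approximate_image[OF fin R x r(2)[of 0]] unfolding P_def by metis
    fix y k assume Pk: "P k y"
    define \<epsilon> where "\<epsilon> = min (r (Suc k)) ((1/2) ^ k)"
    have \<epsilon>: "0 < \<epsilon>" "\<epsilon> \<le> r (Suc k)" "\<epsilon> \<le> (1/2) ^ k" using r(2) by (auto simp: \<epsilon>_def)
    have far: "r k < mdist N x (fst p)" if "p \<in> R" for p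
      using r(3)[of k] \<mu>(2)[OF that] by linarith
    have yN: "y \<in> mspace N" and close: "\<And>p. p \<in> R \<Longrightarrow> \<bar>mdist N y (snd p) - mdist N x (fst p)\<bar> < r k"
      using Pk by (auto simp: P_def)
    obtain y' where y': "y' \<in> mspace N" "mdist N y y' < r k + \<epsilon>"
      "\<And>p. p \<in> R \<Longrightarrow> \<bar>mdist N y' (snd p) - mdist N x (fst p)\<bar> < \<epsilon>"
      using refine_approximate_image[OF fin R x yN r(1,2)[of k] \<epsilon>(1) close far] by metis
    have "P (Suc k) y'"
      using y' \<epsilon>(2) unfolding P_def by (meson less_le_trans)
    moreover have "mdist N y y' < 2 * (1/2) ^ k"
      using y'(2) \<epsilon>(3) r(4)[of k] by linarith
    ultimately show "\<exists>y'. P (Suc k) y' \<and> mdist N y y' < 2 * (1/2) ^ k" by blast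
  qed
  then obtain \<sigma> where \<sigma>: "\<And>k. P k (\<sigma> k)" "\<And>k. mdist N (\<sigma> k) (\<sigma> (Suc k)) < 2 * (1/2) ^ k"
    by blast
  have \<sigma>N: "\<sigma> k \<in> mspace N" for k using \<sigma>(1)[of k] by (simp add: P_def)
  \<comment> \<open>The bound is the partial sum of the geometric series that dominates the steps.\<close>
  have tail: "mdist N (\<sigma> k) (\<sigma> (k + j)) \<le> 4 * (1/2) ^ k - 4 * (1/2) ^ (k + j)" for k j
  proof (induction j)
    case 0 then show ?case using \<sigma>N by simp
  next
    case (Suc j)
    then show ?case
      using mdist_triangle[OF \<sigma>N[of k] \<sigma>N[of "k+j"] \<sigma>N[of "Suc (k+j)"]] \<sigma>(2)[of "k+j"] by simp
  qed
  obtain l where l: "l \<in> mspace N" "(\<lambda>n. mdist N (\<sigma> n) l) \<longlonglongrightarrow> 0"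
  proof (rule mcomplete_of_limit[of N \<sigma>])
    show "mcomplete_of N" using completion by (simp add: is_completion_def)
    show "\<sigma> n \<in> mspace N" for n by (rule \<sigma>N)
    fix e :: real assume "e > 0"
    then obtain K where K: "(1/2) ^ K < e / 8"
      using real_arch_pow_inv[of "e/8" "1/2"] by auto
    have "mdist N (\<sigma> K) (\<sigma> m) < e / 2" if "m \<ge> K" for m
    proof -
      have "0 \<le> (1/2::real) ^ m" by simp
      moreover have "mdist N (\<sigma> K) (\<sigma> m) \<le> 4 * (1/2) ^ K - 4 * (1/2) ^ m"
        using tail[of K "m - K"] that by simp
      ultimately show ?thesis using K by linarith
    qed
    then have "mdist N (\<sigma> m) (\<sigma> n) < e" if "m \<ge> K" "n \<ge> K" for m n
      using that mdist_triangle[OF \<sigma>N[of m] \<sigma>N[of K] \<sigma>N[of n]]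
      by (smt (verit) field_sum_of_halves mdist_commute)
    then show "\<exists>K. \<forall>m\<ge>K. \<forall>n\<ge>K. mdist N (\<sigma> m) (\<sigma> n) < e" by blast
  qed
  have "mdist N l (snd p) = mdist N x (fst p)" if p: "p \<in> R" for p
  proof (rule LIMSEQ_unique)
    show "(\<lambda>n. mdist N (\<sigma> n) (snd p)) \<longlonglongrightarrow> mdist N l (snd p)"
      using mdist_tendsto[OF \<sigma>N l(1) _ l(2)] RN[OF p] by simp
    have bound: "norm (mdist N (\<sigma> n) (snd p) - mdist N x (fst p)) \<le> (1/2) ^ n" for n
      using \<sigma>(1)[of n] p r(4)[of n] unfolding P_def by force
    show "(\<lambda>n. mdist N (\<sigma> n) (snd p)) \<longlonglongrightarrow> mdist N x (fst p)"
      by (rule LIM_zero_cancel, rule Lim_null_comparison[where g = "\<lambda>n. (1/2) ^ n"])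
        (use bound in \<open>auto intro: LIMSEQ_power_zero\<close>)
  qed
  then show ?thesis using partial_isometry_insert[OF R x l(1)] by blast
qed

end

section \<open>Back and forth in a complete separable space\<close>

text \<open>The images of a sequence that converges to \<open>x\<close> form a Cauchy sequence; \<open>y\<close> is its limit.\<close>

lemma partial_isometry_dense_domain:
  assumes N: "mcomplete_of N" and R: "partial_isometry N R" and dense: "metric_dense N (Domain R)"
    and x: "x \<in> mspace N"
  shows "\<exists>y\<in>mspace N. \<forall>p\<in>R. mdist N y (snd p) = mdist N x (fst p)"
proof -
  have RN: "fst p \<in> mspace N" "snd p \<in> mspace N" if "p \<in> R" for p
    using partial_isometryD[OF R that] by simp_all
  have "\<forall>n. \<exists>p\<in>R. mdist N x (fst p) < (1/2) ^ n"
    using dense x unfolding metric_dense_def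
    by (metis Domain.cases fst_conv half_gt_zero_iff zero_less_one zero_less_power)
  then obtain w where w: "\<And>n. w n \<in> R" "\<And>n. mdist N x (fst (w n)) < (1/2) ^ n"
    by metis
  have wN: "fst (w n) \<in> mspace N" "snd (w n) \<in> mspace N" for n using RN w(1) by auto
  obtain y where y: "y \<in> mspace N" "(\<lambda>n. mdist N (snd (w n)) y) \<longlonglongrightarrow> 0"
  proof (rule mcomplete_of_limit[OF N, of "\<lambda>n. snd (w n)"])
    fix e :: real assume "e > 0"
    then obtain K where K: "(1/2) ^ K < e / 2"
      using real_arch_pow_inv[of "e/2" "1/2"] by auto
    have near: "mdist N x (fst (w m)) < e / 2" if "m \<ge> K" for m
    proof -
      have "(1/2::real) ^ m \<le> (1/2) ^ K" using that by (intro power_decreasing) auto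
      then show ?thesis using w(2)[of m] K by linarith
    qed
    have "mdist N (snd (w m)) (snd (w n)) < e" if "m \<ge> K" "n \<ge> K" for m n
    proof -
      have "mdist N (snd (w m)) (snd (w n)) = mdist N (fst (w m)) (fst (w n))"
        using R w(1) by (simp add: partial_isometry_def)
      also have "\<dots> \<le> mdist N x (fst (w m)) + mdist N x (fst (w n))"
        using mdist_triangle[OF wN(1)[of m] x wN(1)[of n]] by (simp add: mdist_commute)
      finally show ?thesis using near[OF that(1)] near[OF that(2)] by linarith
    qed
    then show "\<exists>K. \<forall>m\<ge>K. \<forall>n\<ge>K. mdist N (snd (w m)) (snd (w n)) < e" by blast
  qed (use wN in auto)
  have "mdist N y (snd p) = mdist N x (fst p)" if p: "p \<in> R" for p
  proof (rule LIMSEQ_unique)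
    show "(\<lambda>n. mdist N (snd (w n)) (snd p)) \<longlonglongrightarrow> mdist N y (snd p)"
      using mdist_tendsto[of "\<lambda>n. snd (w n)", OF wN(2) y(1) _ y(2)] RN[OF p] by simp
    have "(\<lambda>n. mdist N (fst (w n)) x) \<longlonglongrightarrow> 0"
    proof (rule Lim_null_comparison[where g = "\<lambda>n. (1/2) ^ n"])
      show "\<forall>\<^sub>F n in sequentially. norm (mdist N (fst (w n)) x) \<le> (1/2) ^ n"
        using w(2) by (intro always_eventually) (simp add: mdist_commute less_imp_le)
    qed (auto intro: LIMSEQ_power_zero)
    then have "(\<lambda>n. mdist N (fst (w n)) (fst p)) \<longlonglongrightarrow> mdist N x (fst p)"
      using mdist_tendsto[of "\<lambda>n. fst (w n)", OF wN(1) x] RN[OF p] by simp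
    moreover have "mdist N (fst (w n)) (fst p) = mdist N (snd (w n)) (snd p)" for n
      using R w(1) p by (simp add: partial_isometry_def)
    ultimately show "(\<lambda>n. mdist N (snd (w n)) (snd p)) \<longlonglongrightarrow> mdist N x (fst p)" by simp
  qed
  with y(1) show ?thesis by blast
qed

text \<open>Points \<open>x\<close> and \<open>y\<close> correspond if they have the same distances to the corresponding points of \<open>R\<close>.
  By density of the domain, this correspondence is isometric and therefore single-valued; it is total, and by
  density of the range and symmetry also surjective.\<close>

lemma partial_isometry_dense_extends:
  assumes N: "mcomplete_of N" and R: "partial_isometry N R"
    and dense: "metric_dense N (Domain R)" "metric_dense N (Range R)"
  obtains g where "automorphism N g" "\<And>x y. (x, y) \<in> R \<Longrightarrow> g x = y"
proof -
  have RN: "fst p \<in> mspace N" "snd p \<in> mspace N" if "p \<in> R" for p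
    using partial_isometryD[OF R that] by simp_all
  define E where "E = (\<lambda>x y. \<forall>p\<in>R. mdist N y (snd p) = mdist N x (fst p))"
  have isometric: "mdist N y y' = mdist N x x'"
    if N4: "x \<in> mspace N" "y \<in> mspace N" "x' \<in> mspace N" "y' \<in> mspace N"
      and E: "E x y" "E x' y'" for x y x' y'
  proof (rule ccontr)
    assume ne: "mdist N y y' \<noteq> mdist N x x'"
    obtain p where p: "p \<in> R" "mdist N x (fst p) < \<bar>mdist N y y' - mdist N x x'\<bar> / 2"
      using dense(1) N4(1) ne unfolding metric_dense_def
      by (metis Domain.cases fst_conv half_gt_zero right_minus_eq zero_less_abs_iff)
    have "\<bar>mdist N y y' - mdist N (snd p) y'\<bar> \<le> mdist N y (snd p)"
      using mdist_quadrilateral[of y N y' "snd p" y'] N4 RN[OF p(1)] by simp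
    moreover have "\<bar>mdist N x x' - mdist N (fst p) x'\<bar> \<le> mdist N x (fst p)"
      using mdist_quadrilateral[of x N x' "fst p" x'] N4 RN[OF p(1)] by simp
    moreover have "mdist N (snd p) y' = mdist N (fst p) x'" "mdist N y (snd p) = mdist N x (fst p)"
      using E p(1) by (auto simp: E_def mdist_commute)
    ultimately have "mdist N y y' - mdist N x x' \<le> 2 * mdist N x (fst p)"
      "mdist N x x' - mdist N y y' \<le> 2 * mdist N x (fst p)"
      by linarith+
    then have "\<bar>mdist N y y' - mdist N x x'\<bar> \<le> 2 * mdist N x (fst p)" by (simp add: abs_le_iff)
    then show False using p(2) by simp
  qed
  have "\<forall>x\<in>mspace N. \<exists>y\<in>mspace N. E x y"
    using partial_isometry_dense_domain[OF N R dense(1)] by (simp add: E_def)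
  then obtain g where g: "\<And>x. x \<in> mspace N \<Longrightarrow> g x \<in> mspace N" "\<And>x. x \<in> mspace N \<Longrightarrow> E x (g x)"
    by metis
  have unique: "g x = y" if "x \<in> mspace N" "y \<in> mspace N" "E x y" for x y
    using isometric[OF that(1) g(1) that(1,2) g(2) that(3)] that g by simp
  have "y \<in> g ` mspace N" if y: "y \<in> mspace N" for y
  proof -
    have "\<exists>x\<in>mspace N. \<forall>p\<in>R\<inverse>. mdist N x (snd p) = mdist N y (fst p)"
      by (rule partial_isometry_dense_domain[OF N partial_isometry_converse[OF R] _ y])
        (simp add: dense(2))
    then obtain x where x: "x \<in> mspace N" "\<And>p. p \<in> R\<inverse> \<Longrightarrow> mdist N x (snd p) = mdist N y (fst p)"
      by blast
    have "mdist N y (snd p) = mdist N x (fst p)" if "p \<in> R" for p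
      using x(2)[of "(snd p, fst p)"] that by simp
    then have "E x y" by (simp add: E_def)
    with x(1) have "x \<in> mspace N" "E x y" .
    then show ?thesis using unique y by blast
  qed
  then have "automorphism N g"
    using g isometric unfolding automorphism_def isometric_embedding_def by auto
  moreover have "g x = y" if "(x, y) \<in> R" for x y
  proof (rule unique)
    show "E x y" using R that by (force simp: E_def partial_isometry_def)
  qed (use RN[OF that] in auto)
  ultimately show ?thesis using that by blast
qed

text \<open>Back and forth: every point of a countable dense set is put in turn into the domain and into the range of
  an increasing chain of finite partial isometries. The union of the chain has dense domain and dense range.\<close>

lemma homogeneous_if_one_point_extensions:
  assumes N: "mcomplete_of N" and S: "countable S" "metric_dense N S"
    and ext: "\<And>R x. finite R \<Longrightarrow> partial_isometry N R \<Longrightarrow> x \<in> mspace N \<Longrightarrow>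
      \<exists>y. partial_isometry N (insert (x, y) R)"
  shows "homogeneous N"
  unfolding homogeneous_def
proof (intro allI impI, elim conjE)
  fix A f assume A: "finite A" "A \<subseteq> mspace N" and f: "isometric_embedding (submetric N A) N f"
  show "\<exists>g. isometric_embedding N N g \<and> g ` mspace N = mspace N \<and> (\<forall>x\<in>A. g x = f x)"
  proof (cases "mspace N = {}")
    case True
    then show ?thesis using A by (auto simp: isometric_embedding_def)
  next
    case False
    then have Sne: "S \<noteq> {}" using S(2) unfolding metric_dense_def
      by (metis all_not_in_conv zero_less_one)
    define s where "s = from_nat_into S"
    have s: "range s = S" using S(1) Sne by (simp add: s_def)
    have sN: "s k \<in> mspace N" for k using s S(2) by (auto simp: metric_dense_def)
    define R0 where "R0 = (\<lambda>x. (x, f x)) ` A"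
    have "f x \<in> mspace N" "mdist N (f x) (f y) = mdist N x y" if "x \<in> A" "y \<in> A" for x y
      using that A(2) f by (auto simp: isometric_embedding_def)
    then have R0: "finite R0" "partial_isometry N R0"
      using A unfolding R0_def partial_isometry_def by auto
    have "\<exists>R. \<forall>k. (finite (R k) \<and> partial_isometry N (R k) \<and> R0 \<subseteq> R k) \<and>
        (R k \<subseteq> R (Suc k) \<and> s k \<in> Domain (R (Suc k)) \<and> s k \<in> Range (R (Suc k)))"
    proof (rule dependent_nat_choice)
      show "\<exists>R. finite R \<and> partial_isometry N R \<and> R0 \<subseteq> R" using R0 by blast
      fix R and k :: nat assume R: "finite R \<and> partial_isometry N R \<and> R0 \<subseteq> R"
      obtain y where y: "partial_isometry N (insert (s k, y) R)"
        using ext[of R "s k"] R sN by blast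
      obtain x where "partial_isometry N (insert (s k, x) ((insert (s k, y) R)\<inverse>))"
        using ext[of "(insert (s k, y) R)\<inverse>" "s k"] partial_isometry_converse[OF y] R sN
        by (auto simp: finite_converse)
      moreover have "(insert (s k, x) ((insert (s k, y) R)\<inverse>))\<inverse> = insert (x, s k) (insert (s k, y) R)"
        by auto
      ultimately have "partial_isometry N (insert (x, s k) (insert (s k, y) R))"
        using partial_isometry_converse by metis
      then show "\<exists>R'. (finite R' \<and> partial_isometry N R' \<and> R0 \<subseteq> R') \<and>
          R \<subseteq> R' \<and> s k \<in> Domain R' \<and> s k \<in> Range R'"
        using R by (intro exI[of _ "insert (x, s k) (insert (s k, y) R)"]) auto
    qed
    then obtain R where R: "\<And>k. partial_isometry N (R k)" "\<And>k. R0 \<subseteq> R k" "\<And>k. R k \<subseteq> R (Suc k)"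
      "\<And>k. s k \<in> Domain (R (Suc k))" "\<And>k. s k \<in> Range (R (Suc k))"
      by blast
    define U where "U = (\<Union>k. R k)"
    have mono: "R j \<subseteq> R k" if "j \<le> k" for j k
      using lift_Suc_mono_le[of R, OF R(3) that] .
    have U: "partial_isometry N U"
      unfolding partial_isometry_def
    proof (intro conjI ballI)
      show "U \<subseteq> mspace N \<times> mspace N" using R(1) by (auto simp: U_def partial_isometry_def)
      fix p q assume "p \<in> U" "q \<in> U"
      then obtain j k where "p \<in> R j" "q \<in> R k" by (auto simp: U_def)
      then have "p \<in> R (max j k)" "q \<in> R (max j k)" using mono[of j "max j k"] mono[of k "max j k"] by auto
      then show "mdist N (fst p) (fst q) = mdist N (snd p) (snd q)"
        using R(1) by (simp add: partial_isometry_def)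
    qed
    have "s k \<in> Domain U" "s k \<in> Range U" for k
      using R(4,5)[of k] unfolding U_def by blast+
    then have "S \<subseteq> Domain U" "S \<subseteq> Range U" using s by auto
    moreover have "Domain U \<subseteq> mspace N" "Range U \<subseteq> mspace N"
      using U by (auto simp: partial_isometry_def)
    ultimately have "metric_dense N (Domain U)" "metric_dense N (Range U)"
      using S(2) unfolding metric_dense_def by blast+
    then obtain g where g: "automorphism N g" "\<And>x y. (x, y) \<in> U \<Longrightarrow> g x = y"
      using partial_isometry_dense_extends[OF N U] by blast
    moreover have "(x, f x) \<in> U" if "x \<in> A" for x
      using R(2)[of 0] that by (auto simp: U_def R0_def)
    ultimately show ?thesis by (auto simp: automorphism_def)
  qed
qed

section \<open>The completion\<close>

text \<open>A point outside the image would be approximated by two different points of \<open>M\<close>, whose distance would be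
  positive but arbitrarily small.\<close>

lemma completion_surj_if_not_small_distances:
  assumes "\<not> small_distances M" and "is_completion M N i"
  shows "i ` mspace M = mspace N"
proof
  have emb: "isometric_embedding M N i" using assms(2) by (simp add: is_completion_def)
  then show sub: "i ` mspace M \<subseteq> mspace N" by (auto simp: isometric_embedding_def)
  have dense: "metric_dense N (i ` mspace M)"
    using assms(2) sub by (simp add: metric_dense_iff_closure_of is_completion_def)
  obtain e where e: "e > 0" "\<And>r. r \<in> dist_set M \<Longrightarrow> 0 < r \<Longrightarrow> e \<le> r"
    using assms(1) unfolding small_distances_def by force
  show "mspace N \<subseteq> i ` mspace M"
  proof
    fix x assume x: "x \<in> mspace N"
    obtain m where m: "m \<in> mspace M" "mdist N x (i m) < e / 2"
      using dense x e(1) unfolding metric_dense_def by (metis half_gt_zero imageE)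
    show "x \<in> i ` mspace M"
    proof (rule ccontr)
      assume "x \<notin> i ` mspace M"
      then have pos: "0 < mdist N x (i m)"
        using m x sub by (metis imageI less_eq_real_def mdist_nonneg mdist_zero subsetD)
      then obtain m' where m': "m' \<in> mspace M" "mdist N x (i m') < mdist N x (i m)"
        using dense x unfolding metric_dense_def by (metis imageE)
      have "m \<noteq> m'" using m'(2) by auto
      then have "0 < mdist M m m'" using m m' by (metis less_eq_real_def mdist_nonneg mdist_zero)
      then have "e \<le> mdist M m m'" using e(2) m m' by (auto simp: dist_set_def)
      moreover have "mdist M m m' \<le> mdist N x (i m) + mdist N x (i m')"
        using emb m m' x sub mdist_triangle[of "i m" N x "i m'"]
        by (auto simp: isometric_embedding_def mdist_commute)
      ultimately show False using m(2) m'(2) by linarith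
    qed
  qed
qed

lemma homogeneous_isometric_image:
  assumes "homogeneous M" and i: "isometric_embedding M N i" "i ` mspace M = mspace N"
  shows "homogeneous N"
  unfolding homogeneous_def
proof (intro allI impI, elim conjE)
  fix A f assume A: "finite A" "A \<subseteq> mspace N" and f: "isometric_embedding (submetric N A) N f"
  have fA: "f x \<in> mspace N" if "x \<in> A" for x
    using f A that by (auto simp: isometric_embedding_def)
  define j where "j = inv_into (mspace M) i"
  have j: "j y \<in> mspace M" "i (j y) = y" if "y \<in> mspace N" for y
    using that i(2) by (auto simp: j_def inv_into_into f_inv_into_f)
  have id: "mdist N (i x) (i y) = mdist M x y" if "x \<in> mspace M" "y \<in> mspace M" for x y
    using i(1) that by (simp add: isometric_embedding_def)
  have jd: "mdist M (j x) (j y) = mdist N x y" if "x \<in> mspace N" "y \<in> mspace N" for x y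
    using id[of "j x" "j y"] j that by simp
  have ji: "j (i x) = x" if "x \<in> mspace M" for x
    using jd[of "i x" "i x"] id[of "j (i x)" x] j[of "i x"] i that
    by (metis imageI mdist_self mdist_zero)
  obtain g where g: "automorphism M g" "\<And>x. x \<in> A \<Longrightarrow> g (j x) = j (f x)"
  proof (rule homogeneous_families[OF assms(1) A(1), of j "\<lambda>x. j (f x)"])
    show "mdist M (j x) (j y) = mdist M (j (f x)) (j (f y))" if "x \<in> A" "y \<in> A" for x y
      using that A f fA by (simp add: jd subset_iff isometric_embedding_def)
  qed (use A fA j in auto)
  show "\<exists>g. isometric_embedding N N g \<and> g ` mspace N = mspace N \<and> (\<forall>x\<in>A. g x = f x)"
  proof (intro exI[of _ "\<lambda>x. i (g (j x))"] conjI ballI)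
    show "isometric_embedding N N (\<lambda>x. i (g (j x)))"
      using g(1) i j jd id by (auto simp: isometric_embedding_def automorphism_in automorphism_mdist)
    have "j ` mspace N = mspace M" using ji j i(2) by force
    moreover have "g ` mspace M = mspace M" using g(1) by (simp add: automorphism_def)
    ultimately show "(\<lambda>x. i (g (j x))) ` mspace N = mspace N"
      using i(2) by (metis image_image)
    show "i (g (j x)) = f x" if "x \<in> A" for x
      using g(2)[OF that] j fA[OF that] by simp
  qed
qed

lemma separable_completion:
  assumes "separable_space (mtopology_of M)" and "is_completion M N i"
  obtains S where "countable S" "metric_dense N S"
proof -
  have emb: "isometric_embedding M N i" using assms(2) by (simp add: is_completion_def)
  then have sub: "i ` mspace M \<subseteq> mspace N" by (auto simp: isometric_embedding_def)
  then have dense: "metric_dense N (i ` mspace M)"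
    using assms(2) by (simp add: metric_dense_iff_closure_of is_completion_def)
  obtain C where C: "countable C" "C \<subseteq> mspace M" "mtopology_of M closure_of C = mspace M"
    using assms(1) by (auto simp: separable_space_def)
  then have denseC: "metric_dense M C" by (simp add: metric_dense_iff_closure_of)
  have "\<exists>c\<in>C. mdist N x (i c) < e" if x: "x \<in> mspace N" and "e > 0" for x e
  proof -
    have e2: "e / 2 > 0" using \<open>e > 0\<close> by simp
    obtain m where m: "m \<in> mspace M" "mdist N x (i m) < e / 2"
      using dense x e2 unfolding metric_dense_def by (metis imageE)
    obtain c where c: "c \<in> C" "mdist M m c < e / 2"
      using denseC m(1) e2 unfolding metric_dense_def by metis
    have "mdist N (i m) (i c) = mdist M m c"
      using emb m c C by (auto simp: isometric_embedding_def)
    then have "mdist N x (i c) < e"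
      using mdist_triangle[of x N "i m" "i c"] x sub m c C(2) by fastforce
    then show ?thesis using c(1) by blast
  qed
  moreover have "i ` C \<subseteq> mspace N" using C(2) sub by blast
  ultimately have "metric_dense N (i ` C)" unfolding metric_dense_def by blast
  then show ?thesis using that C(1) by blast
qed

theorem theorem3:
  fixes M :: "'a metric" and N :: "'b metric" and i :: "'a \<Rightarrow> 'b"
  assumes "universal M"
    and "separable_space (mtopology_of M)"
    and "is_completion M N i"
  shows "homogeneous N"
proof (cases "small_distances M")
  case True
  then interpret universal_completion M N i
    using assms by unfold_locales
  obtain S where "countable S" "metric_dense N S"
    using separable_completion[OF assms(2,3)] .
  moreover have "mcomplete_of N" using assms(3) by (simp add: is_completion_def)
  ultimately show ?thesis
    using homogeneous_if_one_point_extensions completion_one_point_extension by blast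
next
  case False
  then show ?thesis
    using homogeneous_isometric_image[of M N i] completion_surj_if_not_small_distances[OF _ assms(3)]
      assms by (auto simp: universal_def is_completion_def)
qed

end
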